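(* Let $G$ be a connected graph of order $n \ge 2$. Then $\Gamma(G) \le 2R(G)$, with equality if and only if $G \cong K_n$.
   Context: All graphs are finite and simple. The order of $G$ is its number of vertices. $K_n$ is the complete graph on $n$ vertices. A Grundy $k$-coloring of $G$ is a partition of $V(G)$ into $k$ nonempty independent sets $V_1,\dots,V_k$ (color classes) such that for every $i$, every vertex $v\in V_i$ has at least one neighbor in each $V_j$ with $j<i$. The Grundy number $\Gamma(G)$ is the largest $k$ for which $G$ has a Grundy $k$-coloring. The Randić index of $G$ is $R(G)=\sum_{uv\in E(G)} \frac{1}{\sqrt{d(u)d(v)}}$, where $d(u)$ is the degree of $u$ in $G$. *)

theory Defs
  imports
    Complex_Main
    "HOL-Library.Disjoint_Sets"
    "Graph_Theory.Graph_Theory"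
begin

text \<open>
  A finite simple graph is a \<^locale>\<open>graph\<close>: a finite, loop-free, symmetric digraph without
  parallel arcs. An undirected edge is thus a pair of opposite arcs, which \<open>edges\<close> collapses
  to the set of its two ends, and the degree of a vertex is its \<^const>\<open>out_degree\<close>.
\<close>

definition edges :: "('a, 'b) pre_digraph \<Rightarrow> 'a set set" where
  "edges G = {{u, v} | u v. u \<rightarrow>\<^bsub>G\<^esub> v}"

definition randic_index :: "('a, 'b) pre_digraph \<Rightarrow> real" where
  "randic_index G = (\<Sum>e\<in>edges G. 1 / sqrt (\<Prod>v\<in>e. real (out_degree G v)))"

definition independent_set :: "('a, 'b) pre_digraph \<Rightarrow> 'a set \<Rightarrow> bool" where
  "independent_set G S \<longleftrightarrow> S \<subseteq> verts G \<and> (\<forall>u\<in>S. \<forall>v\<in>S. \<not> u \<rightarrow>\<^bsub>G\<^esub> v)"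

text \<open>The color classes are \<open>V 1, \<dots>, V k\<close>; the values of \<open>V\<close> outside \<open>{1..k}\<close> are irrelevant.\<close>

definition grundy_coloring :: "('a, 'b) pre_digraph \<Rightarrow> nat \<Rightarrow> (nat \<Rightarrow> 'a set) \<Rightarrow> bool" where
  "grundy_coloring G k V \<longleftrightarrow>
     (\<Union>i\<in>{1..k}. V i) = verts G \<and> disjoint_family_on V {1..k} \<and>
     (\<forall>i\<in>{1..k}. V i \<noteq> {} \<and> independent_set G (V i)) \<and>
     (\<forall>i\<in>{1..k}. \<forall>v\<in>V i. \<forall>j\<in>{1..<i}. \<exists>u\<in>V j. v \<rightarrow>\<^bsub>G\<^esub> u)"

text \<open>
  For a finite simple graph the set below is bounded by the number of vertices, and it is nonempty
  because the greedy algorithm produces a Grundy coloring; so the maximum exists.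
\<close>

definition grundy_number :: "('a, 'b) pre_digraph \<Rightarrow> nat" where
  "grundy_number G = Max {k. \<exists>V. grundy_coloring G k V}"

definition complete_graph :: "nat \<Rightarrow> nat pair_pre_digraph" where
  "complete_graph n =
     \<lparr> pverts = {..<n}, parcs = {(u, v). (u, v) \<in> {..<n} \<times> {..<n} \<and> u \<noteq> v} \<rparr>"

lemma complete_digraph_complete_graph: "complete_digraph n (with_proj (complete_graph n))"
  unfolding complete_digraph_pair_def by (simp add: complete_graph_def)

end

theory Submission
  imports Defs
begin

text \<open>
  Write \<open>d\<close> for the degree. The inequality is proved for the smaller sum
  \<open>W = (\<Sum>uv. 2 / max (d u) (d v))\<close> over the edges, which is at most \<open>2 R(G)\<close> because the geometric
  mean of two degrees is at most their maximum. What is used of a Grundy \<open>k\<close>-coloring is that any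
  two of its \<open>k\<close> disjoint classes are joined by an edge.

  To see \<open>k \<le> W\<close>, delete vertices in order of decreasing degree. If \<open>s\<close> vertices are already gone
  and \<open>u\<close> has the largest degree among the others, with \<open>d u \<ge> k\<close>, then at least \<open>d u - s\<close> edges at \<open>u\<close>
  survive, and each of them has maximum degree \<open>d u\<close>; their reciprocals add up to at least
  \<open>1 - s / d u \<ge> (k - 1 - s) / (k - 1)\<close>. That is what the vertex number \<open>s + 1\<close> contributes when the
  vertices of \<open>K\<^sub>k\<close> are deleted one by one. Each deletion spoils at most one class, so when all
  remaining degrees are at most \<open>k - 1\<close> there are \<open>j = k - s\<close> intact classes. They span at least
  \<open>j (j - 1) / 2\<close> edges, each with reciprocal at least \<open>1 / (k - 1)\<close>, as for the \<open>K\<^sub>j\<close> left over from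
  \<open>K\<^sub>k\<close>. Hence \<open>W\<close> is at least its value \<open>k\<close> for \<open>K\<^sub>k\<close> (\<open>sum_max_degree_weight_ge_aux\<close>).

  If \<open>\<Gamma>(G) = 2 R(G)\<close>, then the two sums agree term by term, so adjacent vertices have equal degrees
  and the connected graph \<open>G\<close> is regular. For a regular graph with an edge \<open>2 R(G) = n\<close>; so there are
  \<open>n\<close> color classes, all of them singletons, and any two of them are joined: \<open>G\<close> is complete.
  Conversely \<open>2 R(K\<^sub>n) = n\<close>, and in \<open>K\<^sub>n\<close> the \<open>n\<close> singletons form a Grundy coloring.
\<close>

section \<open>Sums over ordered pairs of adjacent vertices\<close>

lemma (in graph) finite_arcs_ends: "finite (arcs_ends G)"
  by (simp add: arcs_ends_def)

lemma (in graph) arcs_ends_subset: "arcs_ends G \<subseteq> verts G \<times> verts G"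
  by (auto simp: adj_in_verts)

lemma (in graph) dominates_sym: "u \<rightarrow> v \<Longrightarrow> v \<rightarrow> u"
  using arcs_ends_symmetric[OF sym_arcs] .

lemma (in graph) finite_neighbors: "finite {v. u \<rightarrow> v}"
  by (rule finite_subset[OF _ finite_verts]) (auto simp: adj_in_verts)

lemma (in graph) out_degree_eq_card_neighbors: "out_degree G u = card {v. u \<rightarrow> v}"
proof -
  have "bij_betw (head G) (out_arcs G u) {v. u \<rightarrow> v}"
    unfolding bij_betw_def
  proof
    show "inj_on (head G) (out_arcs G u)"
      by (auto simp: inj_on_def arc_to_ends_def intro!: no_multi_arcs)
    show "head G ` out_arcs G u = {v. u \<rightarrow> v}"
      by (auto simp: arcs_ends_conv image_iff)
  qed
  then show ?thesis
    unfolding out_degree_def by (rule bij_betw_same_card)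
qed

lemma (in graph) out_degree_pos: "u \<rightarrow> v \<Longrightarrow> 0 < out_degree G u"
  using finite_neighbors[of u] by (auto simp: out_degree_eq_card_neighbors card_gt_0_iff)

text \<open>Each edge \<open>{u, v}\<close> is hit by exactly two ordered pairs, because there are no loops.\<close>

lemma (in graph) twice_randic_index:
  "2 * randic_index G =
     (\<Sum>(u, v)\<in>arcs_ends G. 1 / sqrt (real (out_degree G u) * real (out_degree G v)))"
proof -
  let ?g = "\<lambda>(u, v). 1 / sqrt (real (out_degree G u) * real (out_degree G v))"
  let ?f = "\<lambda>(u, v). {u, v}"
  have edges: "edges G = ?f ` arcs_ends G"
    by (auto simp: edges_def image_iff)
  have fibre: "(\<Sum>p\<in>{p \<in> arcs_ends G. ?f p = e}. ?g p)
      = 2 * (1 / sqrt (\<Prod>v\<in>e. real (out_degree G v)))" if e: "e \<in> edges G" for e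
  proof -
    from e obtain u v where uv: "u \<rightarrow> v" "e = {u, v}"
      by (auto simp: edges_def)
    then have "u \<noteq> v"
      using adj_not_same by blast
    moreover have "{p \<in> arcs_ends G. ?f p = e} = {(u, v), (v, u)}"
      using uv dominates_sym by (auto simp: doubleton_eq_iff)
    ultimately show ?thesis
      using uv by (simp add: mult.commute)
  qed
  have "(\<Sum>p\<in>arcs_ends G. ?g p) = (\<Sum>e\<in>edges G. \<Sum>p\<in>{p \<in> arcs_ends G. ?f p = e}. ?g p)"
    unfolding edges by (rule sum.image_gen[OF finite_arcs_ends])
  also have "\<dots> = 2 * randic_index G"
    unfolding randic_index_def sum_distrib_left by (rule sum.cong[OF refl fibre])
  finally show ?thesis by simp
qed

section \<open>Weighting edges by the larger degree\<close>

text \<open>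
  Half the sum of these weights over all ordered pairs of adjacent vertices is the variant
  \<open>R'(G) = (\<Sum>uv\<in>E(G). 1 / max (d u) (d v))\<close> of the Randic index.
\<close>

definition max_degree_weight :: "('a, 'b) pre_digraph \<Rightarrow> 'a \<times> 'a \<Rightarrow> real" where
  "max_degree_weight G p = 1 / real (max (out_degree G (fst p)) (out_degree G (snd p)))"

lemma (in graph) max_degree_weight_le:
  assumes "u \<rightarrow> v"
  shows "max_degree_weight G (u, v) \<le> 1 / sqrt (real (out_degree G u) * real (out_degree G v))"
    and "max_degree_weight G (u, v) = 1 / sqrt (real (out_degree G u) * real (out_degree G v))
      \<Longrightarrow> out_degree G u = out_degree G v"
proof -
  define a b where "a = real (out_degree G u)" and "b = real (out_degree G v)"
  have pos: "0 < a" "0 < b"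
    using assms out_degree_pos dominates_sym by (auto simp: a_def b_def)
  have w: "max_degree_weight G (u, v) = 1 / max a b"
    by (simp add: max_degree_weight_def a_def b_def of_nat_max)
  have "a * b \<le> (max a b)\<^sup>2"
    using pos by (auto simp: power2_eq_square intro!: mult_mono)
  then have "sqrt (a * b) \<le> max a b"
    using pos by (simp add: real_le_lsqrt)
  then show "max_degree_weight G (u, v) \<le> 1 / sqrt (real (out_degree G u) * real (out_degree G v))"
    using pos unfolding w a_def[symmetric] b_def[symmetric] by (intro divide_left_mono) auto
  assume "max_degree_weight G (u, v) = 1 / sqrt (real (out_degree G u) * real (out_degree G v))"
  then have "max a b = sqrt (a * b)"
    unfolding w a_def[symmetric] b_def[symmetric] using pos by auto
  then have "(max a b)\<^sup>2 = a * b"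
    using pos by simp
  then have "a = b"
    using pos by (auto simp: power2_eq_square max_def split: if_splits)
  then show "out_degree G u = out_degree G v"
    by (simp add: a_def b_def)
qed

lemma (in graph) sum_max_degree_weight_le:
  "sum (max_degree_weight G) (arcs_ends G) \<le> 2 * randic_index G"
  unfolding twice_randic_index by (rule sum_mono) (auto simp: max_degree_weight_le)

lemma (in graph) equal_degrees_if_sum_max_degree_weight_eq:
  assumes "sum (max_degree_weight G) (arcs_ends G) = 2 * randic_index G" and "u \<rightarrow> v"
  shows "out_degree G u = out_degree G v"
proof -
  have "max_degree_weight G (u, v)
      = (case (u, v) of (u, v) \<Rightarrow> 1 / sqrt (real (out_degree G u) * real (out_degree G v)))"
    using assms(1)[unfolded twice_randic_index] _ assms(2) finite_arcs_ends
    by (rule sum_mono_inv) (auto simp: max_degree_weight_le)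
  then show ?thesis
    using max_degree_weight_le(2)[OF assms(2)] by simp
qed

section \<open>Pairwise joined classes\<close>

text \<open>Choosing an arc for every ordered pair of distinct classes is injective by disjointness.\<close>

lemma (in graph) card_arcs_between_classes:
  fixes V :: "'c \<Rightarrow> 'a set"
  assumes fin: "finite C"
    and disj: "disjoint_family_on V C"
    and joined: "\<And>i j. i \<in> C \<Longrightarrow> j \<in> C \<Longrightarrow> i \<noteq> j \<Longrightarrow> \<exists>u\<in>V i. \<exists>v\<in>V j. u \<rightarrow> v"
    and sub: "(\<Union>i\<in>C. V i) \<subseteq> S"
  shows "card C * (card C - 1) \<le> card (arcs_ends G \<inter> S \<times> S)"
proof -
  define P where "P = Sigma C (\<lambda>i. C - {i})"
  have "\<forall>p\<in>P. \<exists>q. q \<in> arcs_ends G \<and> fst q \<in> V (fst p) \<and> snd q \<in> V (snd p)"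
    using joined by (fastforce simp: P_def)
  then obtain f where
    f: "\<And>p. p \<in> P \<Longrightarrow> f p \<in> arcs_ends G \<and> fst (f p) \<in> V (fst p) \<and> snd (f p) \<in> V (snd p)"
    by metis
  have "p = q" if "p \<in> P" "q \<in> P" "f p = f q" for p q
  proof -
    have unique: "i = j" if "i \<in> C" "j \<in> C" "x \<in> V i" "x \<in> V j" for i j x
      using disj that by (auto simp: disjoint_family_on_def)
    have "fst p \<in> C" "fst q \<in> C" "snd p \<in> C" "snd q \<in> C"
      using that by (auto simp: P_def)
    then have "fst p = fst q" "snd p = snd q"
      using that f[of p] f[of q] unique by metis+
    then show ?thesis by (rule prod_eqI)
  qed
  then have "inj_on f P"
    by (auto intro: inj_onI)
  moreover have "f ` P \<subseteq> arcs_ends G \<inter> S \<times> S"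
  proof
    fix q assume "q \<in> f ` P"
    then obtain p where "p \<in> P" "q = f p" by blast
    moreover have "fst p \<in> C" "snd p \<in> C" using calculation(1) by (auto simp: P_def)
    ultimately show "q \<in> arcs_ends G \<inter> S \<times> S"
      using f[of p] sub by (auto simp: mem_Times_iff)
  qed
  ultimately have "card P \<le> card (arcs_ends G \<inter> S \<times> S)"
    using finite_arcs_ends by (intro card_inj_on_le) auto
  moreover have "card P = card C * (card C - 1)"
    using fin by (simp add: P_def)
  ultimately show ?thesis by simp
qed

text \<open>
  The induction behind the lower bound. Here \<open>S\<close> is the set of vertices not yet deleted and \<open>C\<close>
  indexes classes that are still intact; degrees are always taken in the whole graph. The right
  measure of progress is the invariant that the number of deleted vertices plus \<open>card C\<close> stays
  \<open>card I\<close>: it bounds how many edges at the next vertex can already have been lost. With \<open>k = card I\<close>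
  the bound is the weight of a complete graph on \<open>card C\<close> vertices, all of degree \<open>k - 1\<close>.
\<close>

lemma (in graph) sum_max_degree_weight_ge_aux:
  fixes V :: "'c \<Rightarrow> 'a set"
  assumes fin: "finite I" and two: "2 \<le> card I"
    and disj: "disjoint_family_on V I"
    and joined: "\<And>i j. i \<in> I \<Longrightarrow> j \<in> I \<Longrightarrow> i \<noteq> j \<Longrightarrow> \<exists>u\<in>V i. \<exists>v\<in>V j. u \<rightarrow> v"
    and "C \<subseteq> I" "S \<subseteq> verts G" "(\<Union>i\<in>C. V i) \<subseteq> S"
    and "card (verts G - S) + card C = card I"
  shows "real (card C) * (real (card C) - 1) / (real (card I) - 1)
    \<le> sum (max_degree_weight G) (arcs_ends G \<inter> S \<times> S)"
  using assms(5-8)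
proof (induction "card C" arbitrary: C S)
  case 0
  then show ?case
    by (auto intro!: sum_nonneg simp: max_degree_weight_def)
next
  case (Suc m)
  let ?w = "max_degree_weight G" and ?d = "out_degree G"
  define k where "k = real (card I)"
  have k2: "2 \<le> k" using two by (simp add: k_def)
  have finS: "finite S" and finC: "finite C"
    using Suc.prems fin finite_verts finite_subset by blast+
  have fin_arcs: "finite (arcs_ends G \<inter> T)" for T
    using finite_arcs_ends by simp
  show ?case
  proof (cases "\<forall>u\<in>S. ?d u \<le> card I - 1")
    case True
    \<comment> \<open>All weights are at least \<open>1 / (k - 1)\<close>, so it is enough to count arcs.\<close>
    have "real (card C) * (real (card C) - 1) = real (card C * (card C - 1))"
      using Suc.hyps(2) by (simp add: of_nat_diff)
    also have "\<dots> \<le> real (card (arcs_ends G \<inter> S \<times> S))"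
      using card_arcs_between_classes[OF finC disjoint_family_on_mono[OF Suc.prems(1) disj], of S]
        joined Suc.prems by (intro of_nat_mono) blast
    finally have "real (card C) * (real (card C) - 1) / (k - 1)
        \<le> real (card (arcs_ends G \<inter> S \<times> S)) * (1 / (k - 1))"
      using k2 by (simp add: divide_right_mono)
    also have "\<dots> \<le> sum ?w (arcs_ends G \<inter> S \<times> S)"
    proof (rule sum_bounded_below)
      fix p assume p: "p \<in> arcs_ends G \<inter> S \<times> S"
      then have "0 < ?d (fst p)"
        using out_degree_pos[of "fst p" "snd p"] by auto
      moreover have "max (?d (fst p)) (?d (snd p)) \<le> card I - 1"
        using True p by auto
      ultimately have "0 < real (max (?d (fst p)) (?d (snd p)))"
        "real (max (?d (fst p)) (?d (snd p))) \<le> k - 1"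
        using two unfolding k_def by linarith+
      then show "1 / (k - 1) \<le> ?w p"
        unfolding max_degree_weight_def by (intro divide_left_mono) auto
    qed
    finally show ?thesis by (simp add: k_def)
  next
    case False
    then have "S \<noteq> {}" by auto
    \<comment> \<open>Delete a vertex \<open>u\<close> of largest degree; \<open>N\<close> consists of its surviving neighbors.\<close>
    then have "Max (?d ` S) \<in> ?d ` S"
      using finS by (intro Max_in) auto
    then obtain u where uS: "u \<in> S" and dMax: "?d u = Max (?d ` S)"
      by auto
    have umax: "?d x \<le> ?d u" if "x \<in> S" for x
      using finS that unfolding dMax by simp
    define s where "s = card (verts G - S)"
    define N where "N = {v \<in> S. u \<rightarrow> v}"
    have finN: "finite N" using finS by (simp add: N_def)
    have large: "k - 1 < real (?d u)"
      using False umax two unfolding k_def by (force simp: of_nat_diff)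
    have s_eq: "real s = k - 1 - real m"
      using Suc.hyps(2) Suc.prems(4) by (simp add: s_def k_def)
    have "{v. u \<rightarrow> v} \<subseteq> N \<union> (verts G - S)"
      by (auto simp: N_def adj_in_verts)
    then have "card {v. u \<rightarrow> v} \<le> card (N \<union> (verts G - S))"
      using finN by (intro card_mono) auto
    also have "\<dots> \<le> card N + s"
      unfolding s_def by (rule card_Un_le)
    finally have cardN: "real (?d u) - real s \<le> real (card N)"
      by (simp add: out_degree_eq_card_neighbors)
    define A where "A = Pair u ` N \<union> (\<lambda>v. (v, u)) ` N"
    have "u \<notin> N" using adj_not_same by (auto simp: N_def)
    then have "card A = card (Pair u ` N) + card ((\<lambda>v. (v, u)) ` N)"
      unfolding A_def using finN by (intro card_Un_disjoint) auto
    also have "\<dots> = 2 * card N"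
      by (simp add: card_image inj_on_def)
    finally have cardA: "card A = 2 * card N" .
    have "?w p = 1 / real (?d u)" if "p \<in> A" for p
      using that umax by (auto simp: A_def N_def max_degree_weight_def max_absorb1 max_absorb2)
    then have "sum ?w A = 2 * (real (card N) / real (?d u))"
      by (simp add: cardA)
    moreover have "real m / (k - 1) \<le> real (card N) / real (?d u)"
    proof -
      have "real m / (k - 1) = 1 - real s / (k - 1)"
        using k2 by (simp add: s_eq field_simps)
      also have "\<dots> \<le> 1 - real s / real (?d u)"
        using large k2 by (intro diff_left_mono divide_left_mono) auto
      also have "\<dots> = (real (?d u) - real s) / real (?d u)"
        using large k2 by (simp add: field_simps)
      also have "\<dots> \<le> real (card N) / real (?d u)"
        using cardN by (intro divide_right_mono) auto
      finally show ?thesis .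
    qed
    ultimately have sumA: "2 * real m / (k - 1) \<le> sum ?w A"
      by simp
    \<comment> \<open>Give up the class of \<open>u\<close>, or any class if \<open>u\<close> lies in none, to maintain the invariant.\<close>
    obtain i where i: "i \<in> C" "\<And>j. j \<in> C \<Longrightarrow> u \<in> V j \<Longrightarrow> j = i"
    proof (cases "\<exists>i\<in>C. u \<in> V i")
      case True
      then obtain i where "i \<in> C" "u \<in> V i" by blast
      moreover have "j = i" if "j \<in> C" "u \<in> V j" for j
        using disj that calculation Suc.prems(1) unfolding disjoint_family_on_def by blast
      ultimately show ?thesis using that by blast
    next
      case False
      have "C \<noteq> {}" using Suc.hyps(2) by auto
      with False that show ?thesis by blast
    qed
    have "real (card (C - {i})) * (real (card (C - {i})) - 1) / (real (card I) - 1)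
        \<le> sum ?w (arcs_ends G \<inter> (S - {u}) \<times> (S - {u}))"
    proof (rule Suc.hyps(1))
      show "m = card (C - {i})"
        using Suc.hyps(2) i(1) finC by simp
      show "(\<Union>j\<in>C - {i}. V j) \<subseteq> S - {u}"
        using Suc.prems(3) i(2) by blast
      have "verts G - (S - {u}) = insert u (verts G - S)"
        using uS Suc.prems(2) by blast
      then have "card (verts G - (S - {u})) = Suc s"
        using uS by (simp add: s_def)
      then show "card (verts G - (S - {u})) + card (C - {i}) = card I"
        using Suc.hyps(2) Suc.prems(4) i(1) finC by (simp add: s_def)
    qed (use Suc.prems in auto)
    moreover have "card (C - {i}) = m"
      using Suc.hyps(2) i(1) finC by simp
    ultimately have rest: "real m * (real m - 1) / (k - 1)
        \<le> sum ?w (arcs_ends G \<inter> (S - {u}) \<times> (S - {u}))"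
      by (simp add: k_def)
    have split: "arcs_ends G \<inter> S \<times> S = arcs_ends G \<inter> (S - {u}) \<times> (S - {u}) \<union> A"
      using uS dominates_sym adj_not_same by (auto simp: A_def N_def)
    \<comment> \<open>With \<open>card C = m + 1\<close> this is \<open>(m + 1) m = m (m - 1) + 2 m\<close>, divided by \<open>k - 1\<close>.\<close>
    have "real (card C) * (real (card C) - 1) / (k - 1)
        = real m * (real m - 1) / (k - 1) + 2 * real m / (k - 1)"
      unfolding Suc.hyps(2)[symmetric] add_divide_distrib[symmetric] by (simp add: algebra_simps)
    also have "\<dots> \<le> sum ?w (arcs_ends G \<inter> (S - {u}) \<times> (S - {u})) + sum ?w A"
      using rest sumA by (rule add_mono)
    also have "\<dots> = sum ?w (arcs_ends G \<inter> S \<times> S)"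
      unfolding split using finN fin_arcs by (intro sum.union_disjoint[symmetric]) (auto simp: A_def)
    finally show ?thesis by (simp add: k_def)
  qed
qed


lemma (in graph) sum_max_degree_weight_ge:
  fixes V :: "'c \<Rightarrow> 'a set"
  assumes "finite I" and "2 \<le> card I"
    and "disjoint_family_on V I"
    and "\<And>i j. i \<in> I \<Longrightarrow> j \<in> I \<Longrightarrow> i \<noteq> j \<Longrightarrow> \<exists>u\<in>V i. \<exists>v\<in>V j. u \<rightarrow> v"
    and "(\<Union>i\<in>I. V i) \<subseteq> verts G"
  shows "real (card I) \<le> sum (max_degree_weight G) (arcs_ends G)"
proof -
  have "real (card I) = real (card I) * (real (card I) - 1) / (real (card I) - 1)"
    using assms(2) by simp
  also have "\<dots> \<le> sum (max_degree_weight G) (arcs_ends G \<inter> verts G \<times> verts G)"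
    using sum_max_degree_weight_ge_aux[OF assms(1-4) subset_refl subset_refl assms(5)] by simp
  finally show ?thesis
    using arcs_ends_subset by (simp add: inf.absorb1)
qed

section \<open>Grundy colorings\<close>

text \<open>
  First-fit: a new vertex gets the least color not used on its neighbors. The colors given before
  do not change, so the earlier vertices keep the neighbors that they need.
\<close>

lemma (in graph) ex_greedy_coloring:
  assumes "finite S"
  shows "\<exists>c :: 'a \<Rightarrow> nat. (\<forall>u\<in>S. \<forall>v\<in>S. u \<rightarrow> v \<longrightarrow> c u \<noteq> c v) \<and>
    (\<forall>v\<in>S. \<forall>j<c v. \<exists>u\<in>S. v \<rightarrow> u \<and> c u = j)"
  using assms
proof (induction S rule: finite_induct)
  case (insert x S)
  then obtain c :: "'a \<Rightarrow> nat" where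
    proper: "\<forall>u\<in>S. \<forall>v\<in>S. u \<rightarrow> v \<longrightarrow> c u \<noteq> c v" and
    greedy: "\<forall>v\<in>S. \<forall>j<c v. \<exists>u\<in>S. v \<rightarrow> u \<and> c u = j"
    by blast
  define used where "used = c ` {u \<in> S. x \<rightarrow> u}"
  define m where "m = (LEAST j. j \<notin> used)"
  have "\<exists>j. j \<notin> used"
    using insert.hyps(1) by (intro ex_new_if_finite) (auto simp: used_def)
  then have m: "m \<notin> used"
    unfolding m_def by (rule LeastI_ex)
  have below: "j \<in> used" if "j < m" for j
    using that not_less_Least unfolding m_def by blast
  show ?case
  proof (intro exI conjI ballI impI allI)
    fix u v assume "u \<in> insert x S" "v \<in> insert x S" "u \<rightarrow> v"
    then show "(c(x := m)) u \<noteq> (c(x := m)) v"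
      using proper m dominates_sym adj_not_same by (auto simp: used_def)
  next
    fix v j assume v: "v \<in> insert x S" and j: "j < (c(x := m)) v"
    show "\<exists>u\<in>insert x S. v \<rightarrow> u \<and> (c(x := m)) u = j"
    proof (cases "v = x")
      case True
      with j below obtain u where "u \<in> S" "x \<rightarrow> u" "c u = j"
        by (auto simp: used_def)
      with True insert.hyps(2) show ?thesis by auto
    next
      case False
      with v j greedy obtain u where "u \<in> S" "v \<rightarrow> u" "c u = j"
        by auto
      with insert.hyps(2) show ?thesis by auto
    qed
  qed
qed simp

text \<open>
  The classes of a greedy coloring, renumbered from \<open>1\<close>. No color below the largest one is skipped,
  since a vertex of the largest color has a neighbor of each smaller color. The existence of a
  coloring makes the maximum in \<^const>\<open>grundy_number\<close> meaningful.
\<close>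

lemma (in graph) ex_grundy_coloring:
  assumes "verts G \<noteq> {}"
  shows "\<exists>k V. grundy_coloring G k V"
proof -
  obtain c :: "'a \<Rightarrow> nat" where
    proper: "\<And>u v. u \<in> verts G \<Longrightarrow> v \<in> verts G \<Longrightarrow> u \<rightarrow> v \<Longrightarrow> c u \<noteq> c v" and
    greedy: "\<And>v j. v \<in> verts G \<Longrightarrow> j < c v \<Longrightarrow> \<exists>u\<in>verts G. v \<rightarrow> u \<and> c u = j"
    using ex_greedy_coloring[OF finite_verts] by blast
  define M where "M = Max (c ` verts G)"
  have "M \<in> c ` verts G"
    unfolding M_def using assms by (intro Max_in) auto
  then obtain x where x: "x \<in> verts G" "c x = M" by auto
  have le: "c v \<le> M" if "v \<in> verts G" for v
    using that by (simp add: M_def)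
  define V where "V i = {v \<in> verts G. Suc (c v) = i}" for i
  have "V i \<noteq> {}" if "i \<in> {1..Suc M}" for i
  proof (cases "i = Suc M")
    case True with x show ?thesis by (auto simp: V_def)
  next
    case False
    with that have "i - 1 < c x" "Suc (i - 1) = i" using x by auto
    then show ?thesis using greedy[OF x(1), of "i - 1"] by (auto simp: V_def)
  qed
  moreover have "\<exists>u\<in>V j. v \<rightarrow> u" if "v \<in> V i" "j \<in> {1..<i}" for i j v
  proof -
    from that have "j - 1 < c v" "Suc (j - 1) = j" "v \<in> verts G" by (auto simp: V_def)
    then show ?thesis using greedy[of v "j - 1"] by (auto simp: V_def)
  qed
  moreover have "(\<Union>i\<in>{1..Suc M}. V i) = verts G"
    using le by (auto simp: V_def)
  moreover have "independent_set G (V i)" for i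
    using proper by (fastforce simp: independent_set_def V_def)
  moreover have "disjoint_family_on V {1..Suc M}"
    by (auto simp: disjoint_family_on_def V_def)
  ultimately have "grundy_coloring G (Suc M) V"
    unfolding grundy_coloring_def by blast
  then show ?thesis by blast
qed

lemma (in graph) grundy_coloring_le_card:
  assumes "grundy_coloring G k V"
  shows "k \<le> card (verts G)"
proof -
  have "card (\<Union>i\<in>{1..k}. V i) = (\<Sum>i\<in>{1..k}. card (V i))"
    using assms finite_subset[OF _ finite_verts]
    by (intro card_UN_disjoint) (auto simp: grundy_coloring_def disjoint_family_on_def)
  also have "\<dots> \<ge> (\<Sum>i\<in>{1..k}. 1)"
  proof (rule sum_mono)
    fix i assume "i \<in> {1..k}"
    then have "V i \<noteq> {}" "V i \<subseteq> verts G"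
      using assms by (auto simp: grundy_coloring_def)
    then show "1 \<le> card (V i)"
      using finite_subset[OF _ finite_verts] by (simp add: Suc_le_eq card_gt_0_iff)
  qed
  finally show ?thesis
    using assms by (simp add: grundy_coloring_def)
qed

lemma (in graph) finite_grundy_numbers: "finite {k. \<exists>V. grundy_coloring G k V}"
  by (rule finite_subset[of _ "{..card (verts G)}"]) (auto simp: grundy_coloring_le_card)

lemma (in graph) grundy_coloring_le_grundy_number:
  "grundy_coloring G k V \<Longrightarrow> k \<le> grundy_number G"
  unfolding grundy_number_def using finite_grundy_numbers by (intro Max_ge) auto

lemma (in graph) grundy_number_attained:
  assumes "verts G \<noteq> {}"
  obtains V where "grundy_coloring G (grundy_number G) V"
  using Max_in[OF finite_grundy_numbers] ex_grundy_coloring[OF assms] that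
  unfolding grundy_number_def by blast

lemma (in graph) grundy_coloring_classes_joined:
  assumes "grundy_coloring G k V" "i \<in> {1..k}" "j \<in> {1..k}" "i \<noteq> j"
  shows "\<exists>u\<in>V i. \<exists>v\<in>V j. u \<rightarrow> v"
proof (cases "j < i")
  case True
  then show ?thesis
    using assms unfolding grundy_coloring_def by (metis atLeastAtMost_iff atLeastLessThan_iff ex_in_conv)
next
  case False
  then have "i < j" using assms(4) by simp
  then have "\<exists>v\<in>V j. \<exists>u\<in>V i. v \<rightarrow> u"
    using assms unfolding grundy_coloring_def by (metis atLeastAtMost_iff atLeastLessThan_iff ex_in_conv)
  then show ?thesis using dominates_sym by blast
qed

text \<open>The ends of an edge lie in different classes, which provides the two classes needed above.\<close>

lemma (in graph) grundy_coloring_le_sum_max_degree_weight: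
  assumes "grundy_coloring G k V" and "arcs_ends G \<noteq> {}"
  shows "real k \<le> sum (max_degree_weight G) (arcs_ends G)"
proof -
  obtain u v where uv: "u \<rightarrow> v" using assms(2) by auto
  obtain i j where ij: "i \<in> {1..k}" "j \<in> {1..k}" "u \<in> V i" "v \<in> V j"
    using assms(1) adj_in_verts[OF uv] unfolding grundy_coloring_def by blast
  moreover have "i \<noteq> j"
    using assms(1) ij uv unfolding grundy_coloring_def independent_set_def by blast
  ultimately have "2 \<le> card {1..k}" by auto
  then have "real (card {1..k}) \<le> sum (max_degree_weight G) (arcs_ends G)"
    using assms(1) grundy_coloring_classes_joined[OF assms(1)]
    by (intro sum_max_degree_weight_ge[of _ V]) (auto simp: grundy_coloring_def)
  then show ?thesis by simp
qed

section \<open>The case of equality\<close>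

lemma (in graph) twice_randic_index_regular:
  assumes "\<And>u. u \<in> verts G \<Longrightarrow> out_degree G u = d" and "0 < d"
  shows "2 * randic_index G = real (card (verts G))"
proof -
  have "arcs_ends G = (SIGMA u:verts G. {v. u \<rightarrow> v})"
    by (auto simp: adj_in_verts)
  then have "card (arcs_ends G) = card (SIGMA u:verts G. {v. u \<rightarrow> v})"
    by (rule arg_cong)
  also have "\<dots> = (\<Sum>u\<in>verts G. d)"
    using assms(1) finite_neighbors
    by (subst card_SigmaI) (auto simp: out_degree_eq_card_neighbors intro!: sum.cong)
  finally have card: "card (arcs_ends G) = card (verts G) * d" by simp
  have "2 * randic_index G = (\<Sum>p\<in>arcs_ends G. 1 / real d)"
    unfolding twice_randic_index
  proof (rule sum.cong[OF refl])
    fix p assume "p \<in> arcs_ends G"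
    then show "(case p of (u, v) \<Rightarrow> 1 / sqrt (real (out_degree G u) * real (out_degree G v)))
        = 1 / real d"
      using adj_in_verts assms(1) by (cases p) simp
  qed
  then show ?thesis using assms(2) by (simp add: card)
qed

lemma (in graph) connected_out_degree_eq:
  assumes "Digraph_Component.connected G"
    and "\<And>u v. u \<rightarrow> v \<Longrightarrow> out_degree G u = out_degree G v"
    and "x \<in> verts G" "y \<in> verts G"
  shows "out_degree G x = out_degree G y"
proof -
  have "x \<rightarrow>\<^sup>* y"
    using symmetric_connected_imp_strongly_connected[OF sym_arcs assms(1)] assms(3,4)
    by (auto simp: strongly_connected_def)
  then show ?thesis
    by (induction rule: reachable_induct) (use assms(2) in auto)
qed

lemma (in graph) connected_ex_arc:
  assumes "Digraph_Component.connected G" and "2 \<le> card (verts G)"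
  shows "arcs_ends G \<noteq> {}"
proof -
  obtain x y where xy: "x \<in> verts G" "y \<in> verts G" "x \<noteq> y"
    using assms(2) card_le_Suc0_iff_eq[OF finite_verts] by force
  have "x \<rightarrow>\<^sup>* y"
    using symmetric_connected_imp_strongly_connected[OF sym_arcs assms(1)] xy
    by (auto simp: strongly_connected_def)
  then have "x \<rightarrow>\<^sup>+ y" using xy(3) by blast
  then show ?thesis by (auto elim: tranclE)
qed

lemma (in graph) complete_digraphI:
  assumes adj: "\<And>u v. u \<in> verts G \<Longrightarrow> v \<in> verts G \<Longrightarrow> u \<noteq> v \<Longrightarrow> u \<rightarrow> v"
  shows "complete_digraph (card (verts G)) G"
proof -
  have "(u, v) \<in> arcs_ends G \<longleftrightarrow> u \<in> verts G \<and> v \<in> verts G \<and> u \<noteq> v" for u v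
    using adj adj_in_verts adj_not_same by blast
  then have "arcs_ends G = {(u, v). (u, v) \<in> verts G \<times> verts G \<and> u \<noteq> v}"
    by auto
  then show ?thesis
    by (simp add: complete_digraph_def graph_axioms)
qed

text \<open>
  With as many classes as vertices, a choice \<open>f\<close> of one vertex from each class already exhausts the
  graph. So the classes are singletons, and any two of them are joined.
\<close>

lemma (in graph) complete_if_grundy_coloring_card:
  assumes "grundy_coloring G (card (verts G)) V"
  shows "complete_digraph (card (verts G)) G"
proof -
  let ?n = "card (verts G)"
  note col = assms[unfolded grundy_coloring_def]
  define f where "f i = (SOME v. v \<in> V i)" for i
  have f: "f i \<in> V i" if "i \<in> {1..?n}" for i
    using col that by (auto simp: f_def some_in_eq)
  have unique: "i = j" if "i \<in> {1..?n}" "j \<in> {1..?n}" "v \<in> V i" "v \<in> V j" for i j v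
    using col that unfolding disjoint_family_on_def by blast
  have "inj_on f {1..?n}"
  proof (rule inj_onI)
    fix i j assume "i \<in> {1..?n}" "j \<in> {1..?n}" "f i = f j"
    then show "i = j" using f[of i] f[of j] unique[of i j "f i"] by simp
  qed
  moreover have sub: "f ` {1..?n} \<subseteq> verts G"
    using f col by blast
  ultimately have surj: "f ` {1..?n} = verts G"
    by (intro card_subset_eq) (auto simp: card_image)
  have single: "V i = {f i}" if "i \<in> {1..?n}" for i
  proof -
    have "v = f i" if v: "v \<in> V i" for v
    proof -
      have "v \<in> verts G" using col v \<open>i \<in> {1..?n}\<close> by blast
      then obtain j where j: "j \<in> {1..?n}" "v = f j" using surj by blast
      then have "j = i"
        using unique[of j i v] f[of j] v \<open>i \<in> {1..?n}\<close> by simp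
      with j show ?thesis by simp
    qed
    then show ?thesis using f[OF that] by blast
  qed
  have "u \<rightarrow> v" if uv: "u \<in> verts G" "v \<in> verts G" "u \<noteq> v" for u v
  proof -
    obtain i j where ij: "i \<in> {1..?n}" "j \<in> {1..?n}" "u = f i" "v = f j"
      using uv surj by blast
    then show ?thesis
      using grundy_coloring_classes_joined[OF assms, of i j] uv(3) single by auto
  qed
  then show ?thesis by (rule complete_digraphI)
qed

lemma (in graph) complete_out_degree:
  assumes "complete_digraph n G" and "u \<in> verts G"
  shows "out_degree G u = n - 1"
proof -
  have "{v. u \<rightarrow> v} = verts G - {u}"
    using assms by (auto simp: complete_digraph_def)
  then show ?thesis
    using assms by (simp add: out_degree_eq_card_neighbors complete_digraph_def)
qed

lemma (in graph) complete_grundy_coloring: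
  assumes "complete_digraph n G"
  obtains V where "grundy_coloring G n V"
proof -
  have n: "card (verts G) = n" and ends: "arcs_ends G = {(u, v). (u, v) \<in> verts G \<times> verts G \<and> u \<noteq> v}"
    using assms by (auto simp: complete_digraph_def)
  obtain f where f: "bij_betw f {1..n} (verts G)"
    using ex_bij_betw_nat_finite_1[OF finite_verts] n by auto
  have inj: "f i = f j \<longleftrightarrow> i = j" if "i \<in> {1..n}" "j \<in> {1..n}" for i j
    using f that by (meson bij_betw_imp_inj_on inj_on_eq_iff)
  have verts: "f ` {1..n} = verts G"
    using f by (rule bij_betw_imp_surj_on)
  have "grundy_coloring G n (\<lambda>i. {f i})"
    unfolding grundy_coloring_def independent_set_def disjoint_family_on_def
  proof (intro conjI ballI impI)
    fix i v j assume "i \<in> {1..n}" "v \<in> {f i}" "j \<in> {1..<i}"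
    then show "\<exists>u\<in>{f j}. v \<rightarrow> u"
      using verts inj[of i j] by (auto simp: ends)
  qed (use verts inj ends in auto)
  then show thesis by (rule that)
qed

lemma (in graph) digraph_iso_complete_graph_iff:
  "digraph_iso G (with_proj (complete_graph n)) \<longleftrightarrow> complete_digraph n G"
proof
  let ?K = "with_proj (complete_graph n)"
  assume "digraph_iso G ?K"
  then obtain h where h: "digraph_isomorphism h" and K: "?K = app_iso h G"
    by (auto simp: digraph_iso_def)
  let ?f = "iso_verts h"
  have inj: "inj_on ?f (verts G)"
    using h by (rule digraph_isomorphism_inj_on_verts)
  have verts: "?f ` verts G = {..<n}"
    using arg_cong[OF K, of verts] by (simp add: complete_graph_def)
  have arcs: "iso_arcs h ` arcs G = {(i, j). i < n \<and> j < n \<and> i \<noteq> j}"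
    using arg_cong[OF K, of arcs] by (auto simp: complete_graph_def)
  have ht: "iso_tail h = fst" "iso_head h = snd"
    using arg_cong[OF K, of tail] arg_cong[OF K, of head] by simp_all
  have adj: "u \<rightarrow> v" if uv: "u \<in> verts G" "v \<in> verts G" "u \<noteq> v" for u v
  proof -
    have "(?f u, ?f v) \<in> iso_arcs h ` arcs G"
      using uv inj verts unfolding arcs by (auto simp: inj_on_eq_iff)
    then obtain a where a: "a \<in> arcs G" "iso_arcs h a = (?f u, ?f v)"
      by auto
    then have "?f (tail G a) = ?f u" "?f (head G a) = ?f v"
      using h ht by (auto simp: digraph_isomorphism_def)
    then have "tail G a = u" "head G a = v"
      using inj uv a(1) by (auto simp: inj_on_eq_iff)
    then show ?thesis using a(1) by (auto simp: arcs_ends_conv)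
  qed
  have "card (verts G) = n"
    using card_image[OF inj] verts by simp
  then show "complete_digraph n G"
    using complete_digraphI[OF adj] by simp
next
  let ?K = "with_proj (complete_graph n)"
  assume c: "complete_digraph n G"
  then have n: "card (verts G) = n" and ends: "arcs_ends G = {(u, v). (u, v) \<in> verts G \<times> verts G \<and> u \<noteq> v}"
    by (auto simp: complete_digraph_def)
  obtain f where f: "bij_betw f (verts G) {..<n}"
    using ex_bij_betw_finite_nat[OF finite_verts] n by (auto simp: atLeast0LessThan)
  \<comment> \<open>An arc of the target is the pair of its ends, which forces the image of each arc.\<close>
  define h where "h = \<lparr>iso_verts = f, iso_arcs = (\<lambda>a. map_prod f f (arc_to_ends G a)),
    iso_head = snd, iso_tail = fst\<rparr>"
  have inj: "inj_on f (verts G)" and fv: "f ` verts G = {..<n}"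
    using f by (auto simp: bij_betw_def)
  have inj2: "inj_on (map_prod f f) (arcs_ends G)"
    using map_prod_inj_on[OF inj inj] arcs_ends_subset by (rule inj_on_subset)
  have "inj_on (\<lambda>a. map_prod f f (arc_to_ends G a)) (arcs G)"
    using comp_inj_on[OF inj_on_arc_to_ends inj2[unfolded arcs_ends_def]] by (simp add: comp_def)
  then have "digraph_isomorphism h"
    using inj by (auto simp: digraph_isomorphism_def h_def arc_to_ends_def wf_digraph)
  moreover have "iso_arcs h ` arcs G = map_prod f f ` arcs_ends G"
    by (simp add: h_def arcs_ends_def image_image)
  moreover have "map_prod f f ` arcs_ends G = {(i, j). (i, j) \<in> {..<n} \<times> {..<n} \<and> i \<noteq> j}"
  proof (intro equalityI subsetI)
    fix p assume "p \<in> map_prod f f ` arcs_ends G"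
    then show "p \<in> {(i, j). (i, j) \<in> {..<n} \<times> {..<n} \<and> i \<noteq> j}"
      using inj fv by (auto simp: ends inj_on_eq_iff)
  next
    fix p assume "p \<in> {(i, j). (i, j) \<in> {..<n} \<times> {..<n} \<and> i \<noteq> j}"
    then have "fst p \<in> f ` verts G" "snd p \<in> f ` verts G" "fst p \<noteq> snd p"
      by (auto simp: fv)
    then obtain u v where "u \<in> verts G" "v \<in> verts G" "f u \<noteq> f v" "p = (f u, f v)"
      by (cases p) auto
    then show "p \<in> map_prod f f ` arcs_ends G"
      by (auto simp: ends intro!: image_eqI[of _ _ "(u, v)"])
  qed
  ultimately have "digraph_isomorphism h" "?K = app_iso h G"
    using fv by (auto simp: app_iso_def with_proj_def complete_graph_def h_def)
  then show "digraph_iso G ?K"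
    by (auto simp: digraph_iso_def)
qed

theorem corollary2p3:
  fixes G :: "('a, 'b) pre_digraph" and n :: nat
  assumes "graph G"
    and "Digraph_Component.connected G"
    and "card (verts G) = n"
    and "n \<ge> 2"
  shows "real (grundy_number G) \<le> 2 * randic_index G \<and>
    (real (grundy_number G) = 2 * randic_index G \<longleftrightarrow>
      digraph_iso G (with_proj (complete_graph n)))"
proof -
  interpret graph G by fact
  let ?k = "grundy_number G" and ?W = "sum (max_degree_weight G) (arcs_ends G)"
  have "verts G \<noteq> {}" using assms(3,4) by auto
  then obtain V where V: "grundy_coloring G ?k V" by (rule grundy_number_attained)
  have arcs: "arcs_ends G \<noteq> {}"
    using assms connected_ex_arc by simp
  have W: "real ?k \<le> ?W" "?W \<le> 2 * randic_index G"
    using grundy_coloring_le_sum_max_degree_weight[OF V arcs] sum_max_degree_weight_le .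
  have "complete_digraph n G" if eq: "real ?k = 2 * randic_index G"
  proof -
    have "?W = 2 * randic_index G" using W eq by simp
    then have step: "out_degree G u = out_degree G v" if "u \<rightarrow>\<^bsub>G\<^esub> v" for u v
      using that equal_degrees_if_sum_max_degree_weight_eq by blast
    obtain x y where xy: "x \<rightarrow>\<^bsub>G\<^esub> y" using arcs by auto
    have "out_degree G u = out_degree G x" if "u \<in> verts G" for u
      using connected_out_degree_eq[OF assms(2) step that] adj_in_verts[OF xy] by simp
    then have "2 * randic_index G = real n"
      using twice_randic_index_regular out_degree_pos[OF xy] assms(3) by blast
    then have "?k = card (verts G)" using eq assms(3) by simp
    then show ?thesis
      using complete_if_grundy_coloring_card V assms(3) by simp
  qed
  moreover have "real ?k = 2 * randic_index G" if c: "complete_digraph n G"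
  proof -
    have "2 * randic_index G = real n"
      using twice_randic_index_regular[of "n - 1"] complete_out_degree[OF c] assms(3,4) by simp
    moreover obtain U where "grundy_coloring G n U" using complete_grundy_coloring[OF c] .
    then have "n \<le> ?k" by (rule grundy_coloring_le_grundy_number)
    ultimately show ?thesis using W by simp
  qed
  ultimately show ?thesis
    using order_trans[OF W] digraph_iso_complete_graph_iff by blast
qed

end
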